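(* Let $\mathcal{D}$ be a probability distribution with finite support $\mathcal{K}$, let $p_1\ge p_2\ge\dots\ge p_{|\mathcal{K}|}$ be the values assumed (with multiplicity) by its probability mass function, and let $T_{\mathsf{QKG}}:=\sum_{i=1}^{|\mathcal{K}|}\sqrt{i}\,p_i$ be the expected runtime (up to a constant factor) of Montanaro's quantum algorithm for single-key guessing on $\mathcal{D}$. Then $$\frac{2^{\frac{\mathrm{H}_{2/3}(\mathcal{D})}{2}}}{\sqrt{1+\log|\mathcal{K}|}}\;\le\;T_{\mathsf{QKG}}\;\le\;2^{\frac{\mathrm{H}_{2/3}(\mathcal{D})}{2}}.$$
   Context: All logarithms are base 2. For $\alpha>0$, $\alpha\ne1$, the Rényi entropy of a discrete distribution $\mathcal{D}$ with support $\mathcal{K}$ and mass function $P_{\mathcal{D}}$ is $\mathrm{H}_\alpha(\mathcal{D})=\frac{1}{1-\alpha}\log\left(\sum_{x\in\mathcal{K}}P_{\mathcal{D}}(x)^\alpha\right)$. Single-key guessing problem: for $k\leftarrow\mathcal{D}$, given a description of $\mathcal{D}$ and oracle access to $\mathbb{1}_k:\mathcal{K}\to\{0,1\}$ (with $\mathbb{1}_k(x)=1$ iff $x=k$), find $k$. Montanaro's quantum algorithm solves this in expected time at most $e\pi\sum_i\sqrt{i}\,p_i$, which is optimal up to constant factors; the quantity $\sum_i\sqrt i\,p_i$ is taken as the quantum complexity of single-key guessing. *)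

theory Defs
  imports "HOL-Probability.Probability" "HOL-Library.Multiset"
begin

text \<open>The support of a discrete distribution \<open>D\<close> is \<open>set_pmf D\<close>, the set of points of positive
  mass. The definition below is meant for finite support and \<open>\<alpha> > 0\<close>, \<open>\<alpha> \<noteq> 1\<close>;
  logarithms are base 2.\<close>

definition renyi_entropy :: "real \<Rightarrow> 'a pmf \<Rightarrow> real" where
  "renyi_entropy \<alpha> D = 1 / (1 - \<alpha>) * log 2 (\<Sum>x\<in>set_pmf D. pmf D x powr \<alpha>)"

text \<open>The list of the masses of the support points, with multiplicity, in nonincreasing order;
  meaningful for finite support only.\<close>

definition sorted_masses :: "'a pmf \<Rightarrow> real list" where
  "sorted_masses D = rev (sorted_list_of_multiset (image_mset (pmf D) (mset_set (set_pmf D))))"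

lemma mset_sorted_masses:
  "mset (sorted_masses D) = image_mset (pmf D) (mset_set (set_pmf D))"
  by (simp add: sorted_masses_def)

lemma length_sorted_masses: "length (sorted_masses D) = card (set_pmf D)"
  by (metis mset_sorted_masses size_image_mset size_mset size_mset_set)

lemma sorted_wrt_sorted_masses: "sorted_wrt (\<ge>) (sorted_masses D)"
  by (simp add: sorted_masses_def sorted_wrt_rev)

text \<open>The complexity \<open>\<Sum>\<^sub>i \<surd>i p\<^sub>i\<close> of quantum single-key guessing, with \<open>i\<close> starting at 1; since list
  positions start at 0, \<open>p\<^sub>i\<close> is the entry at position \<open>i - 1\<close>.\<close>

definition T_QKG :: "'a pmf \<Rightarrow> real" where
  "T_QKG D = (\<Sum>i = 1..card (set_pmf D). sqrt (real i) * sorted_masses D ! (i - 1))"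

end

theory Submission
  imports Defs
begin

text \<open>Put \<open>S = (\<Sum>i. p\<^sub>i powr (2/3))\<close>, so that \<open>2 powr (H / 2) = S powr (3/2)\<close> for the Renyi entropy
  \<open>H\<close> of order \<open>2/3\<close>. Upper bound: as \<open>p\<close> is nonincreasing, \<open>i * p\<^sub>i powr (2/3) \<le> S\<close>, i.e.
  \<open>\<surd>i * p\<^sub>i powr (1/3) \<le> \<surd>S\<close>; multiply by \<open>p\<^sub>i powr (2/3)\<close> and sum over \<open>i\<close>. Lower bound: apply
  Hoelder's inequality with exponents \<open>3/2\<close> and \<open>3\<close> to
  \<open>p\<^sub>i powr (2/3) = (\<surd>i * p\<^sub>i) powr (2/3) * (1/i) powr (1/3)\<close> and bound the harmonic number by
  \<open>1 + ln n\<close>.\<close>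

text \<open>After dividing by \<open>A\<close> and \<open>B\<close> both families sum to 1, and
  Young's inequality applied to each index adds up to at most \<open>\<alpha> + \<beta> = 1\<close>.
  For empty or infinite \<open>I\<close> both sides are 0.\<close>

lemma Holder_ineq_sum:
  fixes a b :: "'i \<Rightarrow> real"
  assumes "0 \<le> \<alpha>" "0 \<le> \<beta>" "\<alpha> + \<beta> = 1"
    and "\<And>i. i \<in> I \<Longrightarrow> 0 < a i" "\<And>i. i \<in> I \<Longrightarrow> 0 < b i"
  shows "(\<Sum>i\<in>I. a i powr \<alpha> * b i powr \<beta>) \<le> (\<Sum>i\<in>I. a i) powr \<alpha> * (\<Sum>i\<in>I. b i) powr \<beta>"
proof (cases "finite I \<and> I \<noteq> {}")
  case True
  define A where "A = (\<Sum>i\<in>I. a i)"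
  define B where "B = (\<Sum>i\<in>I. b i)"
  have "A > 0" "B > 0"
    unfolding A_def B_def using True assms by (auto intro!: sum_pos)
  have "(\<Sum>i\<in>I. (a i / A) powr \<alpha> * (b i / B) powr \<beta>) \<le> (\<Sum>i\<in>I. \<alpha> * (a i / A) + \<beta> * (b i / B))"
    using assms \<open>A > 0\<close> \<open>B > 0\<close> by (intro sum_mono Youngs_inequality_0) auto
  also have "\<dots> = \<alpha> * (A / A) + \<beta> * (B / B)"
    unfolding sum.distrib by (simp add: A_def B_def flip: sum_distrib_left sum_divide_distrib)
  also have "\<dots> = 1"
    using \<open>A > 0\<close> \<open>B > 0\<close> assms(3) by simp
  finally have "(\<Sum>i\<in>I. (a i / A) powr \<alpha> * (b i / B) powr \<beta>) \<le> 1" .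
  moreover have "(\<Sum>i\<in>I. (a i / A) powr \<alpha> * (b i / B) powr \<beta>)
      = (\<Sum>i\<in>I. a i powr \<alpha> * b i powr \<beta>) / (A powr \<alpha> * B powr \<beta>)"
    using assms(4,5) \<open>A > 0\<close> \<open>B > 0\<close>
    by (simp add: sum_divide_distrib powr_divide less_imp_le)
  ultimately show ?thesis
    using \<open>A > 0\<close> \<open>B > 0\<close> by (simp add: A_def B_def pos_divide_le_eq)
qed auto

text \<open>The sequence \<open>harm (Suc m) - ln (Suc m)\<close> is decreasing and starts at 1;
  comparing indices 0 and \<open>n - 1\<close> gives the bound.\<close>

lemma harm_le_ln: "0 < n \<Longrightarrow> harm n \<le> 1 + ln (real n)"
  using decseqD[OF decseq_harm_diff_ln, of 0 "n - 1"] by (simp add: harm_expand)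

lemma ln_le_log2:
  fixes x :: real
  assumes "1 \<le> x"
  shows "ln x \<le> log 2 x"
proof -
  have "ln x * ln 2 \<le> ln x * 1"
    using assms ln_less_self[of 2] ln_2_less_1 by (intro mult_left_mono) auto
  then show ?thesis
    by (simp add: log_def pos_le_divide_eq)
qed

lemma sum_sqrt_mult_le:
  fixes p :: "nat \<Rightarrow> real"
  assumes nonneg: "\<And>i. i \<in> {1..n} \<Longrightarrow> 0 \<le> p i"
    and decr: "\<And>i j. 1 \<le> i \<Longrightarrow> i \<le> j \<Longrightarrow> j \<le> n \<Longrightarrow> p j \<le> p i"
  shows "(\<Sum>i=1..n. sqrt (real i) * p i) \<le> (\<Sum>i=1..n. p i powr (2/3)) powr (3/2)"
proof -
  define S where "S = (\<Sum>i=1..n. p i powr (2/3))"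
  have "0 \<le> S"
    by (simp add: S_def sum_nonneg)
  have "sqrt (real i) * p i \<le> S powr (1/2) * p i powr (2/3)" if i: "i \<in> {1..n}" for i
  proof -
    have "real i * p i powr (2/3) = (\<Sum>j=1..i. p i powr (2/3))"
      by simp
    \<comment> \<open>Among the first \<open>i\<close> values the last is the smallest.\<close>
    also have "\<dots> \<le> (\<Sum>j=1..i. p j powr (2/3))"
      using i nonneg decr by (intro sum_mono powr_mono2) auto
    also have "\<dots> \<le> S"
      unfolding S_def using i by (intro sum_mono2) auto
    finally have "(real i * p i powr (2/3)) powr (1/2) \<le> S powr (1/2)"
      by (intro powr_mono2) auto
    then have "sqrt (real i) * p i powr (1/3) \<le> S powr (1/2)"
      by (simp add: powr_mult powr_powr powr_half_sqrt)
    then have "sqrt (real i) * p i powr (1/3) * p i powr (2/3) \<le> S powr (1/2) * p i powr (2/3)"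
      by (intro mult_right_mono) auto
    moreover have "p i powr (1/3) * p i powr (2/3) = p i"
      using nonneg[OF i] by (simp flip: powr_add)
    ultimately show ?thesis
      by (simp add: mult.assoc)
  qed
  then have "(\<Sum>i=1..n. sqrt (real i) * p i) \<le> (\<Sum>i=1..n. S powr (1/2) * p i powr (2/3))"
    by (rule sum_mono)
  \<comment> \<open>Keeping the second factor as \<open>S powr 1\<close> lets
    \<open>powr_add\<close> merge the exponents.\<close>
  also have "\<dots> = S powr (1/2) * S powr 1"
    using \<open>0 \<le> S\<close> by (simp add: S_def flip: sum_distrib_left)
  also have "\<dots> = S powr (3/2)"
    by (simp only: powr_add[symmetric]) simp
  finally show ?thesis
    by (simp add: S_def)
qed

lemma sum_sqrt_mult_ge:
  fixes p :: "nat \<Rightarrow> real"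
  assumes pos: "\<And>i. i \<in> {1..n} \<Longrightarrow> 0 < p i"
  shows "(\<Sum>i=1..n. p i powr (2/3)) powr (3/2) \<le> (\<Sum>i=1..n. sqrt (real i) * p i) * sqrt (harm n)"
proof -
  define T where "T = (\<Sum>i=1..n. sqrt (real i) * p i)"
  have "0 \<le> T"
    unfolding T_def using pos by (intro sum_nonneg) (auto intro: less_imp_le)
  have "p i powr (2/3) = (sqrt (real i) * p i) powr (2/3) * inverse (real i) powr (1/3)"
    if "i \<in> {1..n}" for i
  proof -
    have "sqrt (real i) powr (2/3) = real i powr (1/3)"
      by (simp add: powr_powr flip: powr_half_sqrt)
    moreover have "real i powr (1/3) * inverse (real i) powr (1/3) = 1"
      using that by (simp flip: powr_mult)
    ultimately show ?thesis
      by (simp add: powr_mult mult_ac)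
  qed
  then have "(\<Sum>i=1..n. p i powr (2/3))
      = (\<Sum>i=1..n. (sqrt (real i) * p i) powr (2/3) * inverse (real i) powr (1/3))"
    by (rule sum.cong[OF refl])
  also have "\<dots> \<le> T powr (2/3) * harm n powr (1/3)"
    unfolding T_def harm_def using pos by (intro Holder_ineq_sum) auto
  \<comment> \<open>Raising to the power 3/2 turns the exponents 2/3 and 1/3 into 1 and 1/2.\<close>
  finally have "(\<Sum>i=1..n. p i powr (2/3)) powr (3/2) \<le> (T powr (2/3) * harm n powr (1/3)) powr (3/2)"
    by (intro powr_mono2) (auto intro: sum_nonneg)
  also have "\<dots> = T * sqrt (harm n)"
    using \<open>0 \<le> T\<close> harm_nonneg[of n, where 'a = real]
    by (simp add: powr_mult powr_powr powr_half_sqrt)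
  finally show ?thesis
    by (simp add: T_def)
qed

text \<open>Sorting only permutes the multiset of masses, so a symmetric sum may be taken over the
  support instead. For infinite support both sides are 0.\<close>

lemma sum_sorted_masses:
  fixes f :: "real \<Rightarrow> real"
  shows "(\<Sum>i=1..card (set_pmf D). f (sorted_masses D ! (i - 1))) = (\<Sum>x\<in>set_pmf D. f (pmf D x))"
proof -
  have "(\<Sum>i=1..card (set_pmf D). f (sorted_masses D ! (i - 1)))
      = (\<Sum>i<length (sorted_masses D). f (sorted_masses D ! i))"
    by (rule sum.reindex_bij_witness[of _ Suc "\<lambda>i. i - 1"]) (auto simp: length_sorted_masses)
  also have "\<dots> = sum_list (map f (sorted_masses D))"
    by (simp add: sum_list_sum_nth lessThan_atLeast0)
  also have "\<dots> = sum_mset (image_mset f (mset (sorted_masses D)))"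
    by (simp flip: sum_mset_sum_list)
  also have "\<dots> = (\<Sum>x\<in>set_pmf D. f (pmf D x))"
    by (simp add: mset_sorted_masses multiset.map_comp comp_def sum_unfold_sum_mset)
  finally show ?thesis .
qed

text \<open>At order 2/3 the prefactor \<open>1 / (1 - \<alpha>)\<close> is 3, and halving it leaves
  the exponent 3/2.\<close>

lemma two_powr_renyi_entropy_two_thirds:
  assumes "finite (set_pmf D)"
  shows "2 powr (renyi_entropy (2/3) D / 2) = (\<Sum>x\<in>set_pmf D. pmf D x powr (2/3)) powr (3/2)"
proof -
  define S where "S = (\<Sum>x\<in>set_pmf D. pmf D x powr (2/3))"
  \<comment> \<open>The support is nonempty with positive masses; positivity is what makes
    \<open>2 powr log 2 S\<close> equal to \<open>S\<close>.\<close>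
  have "S > 0"
    unfolding S_def using assms
    by (intro sum_pos) (auto simp: set_pmf_not_empty set_pmf_iff)
  have "2 powr (log 2 S * (3/2)) = S powr (3/2)"
    using \<open>S > 0\<close> powr_powr[of 2 "log 2 S" "3/2"] by simp
  moreover have "renyi_entropy (2/3) D / 2 = log 2 S * (3/2)"
    by (simp add: renyi_entropy_def S_def)
  ultimately show ?thesis
    by (simp add: S_def)
qed

theorem theorem4p2:
  fixes D :: "'a pmf"
  assumes "finite (set_pmf D)"
  shows "2 powr (renyi_entropy (2/3) D / 2) / sqrt (1 + log 2 (real (card (set_pmf D)))) \<le> T_QKG D
         \<and> T_QKG D \<le> 2 powr (renyi_entropy (2/3) D / 2)"
proof -
  define n where "n = card (set_pmf D)"
  define p where "p i = sorted_masses D ! (i - 1)" for i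
  have "n > 0"
    using assms by (simp add: n_def card_gt_0_iff set_pmf_not_empty)
  have T: "T_QKG D = (\<Sum>i=1..n. sqrt (real i) * p i)"
    by (simp add: T_QKG_def n_def p_def)
  have H: "2 powr (renyi_entropy (2/3) D / 2) = (\<Sum>i=1..n. p i powr (2/3)) powr (3/2)"
    using sum_sorted_masses[of "\<lambda>x. x powr (2/3)" D] two_powr_renyi_entropy_two_thirds[OF assms]
    by (simp add: n_def p_def)
  \<comment> \<open>Every list entry is the mass of a support point, which gives the strict
    positivity required for the lower bound.\<close>
  have pos: "0 < p i" if "i \<in> {1..n}" for i
  proof -
    have "p i \<in> set (sorted_masses D)"
      using that by (auto simp: p_def n_def length_sorted_masses intro!: nth_mem)
    also have "set (sorted_masses D) = pmf D ` set_pmf D"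
      using assms by (simp add: mset_sorted_masses flip: set_mset_mset)
    finally show ?thesis
      by (auto intro: pmf_positive)
  qed
  have decr: "p j \<le> p i" if "1 \<le> i" "i \<le> j" "j \<le> n" for i j
  proof (cases "i = j")
    case False
    then show ?thesis
      using that sorted_wrt_nth_less[OF sorted_wrt_sorted_masses, of "i - 1" "j - 1" D]
      by (simp add: p_def n_def length_sorted_masses)
  qed simp
  have upper: "T_QKG D \<le> 2 powr (renyi_entropy (2/3) D / 2)"
    unfolding T H using pos decr by (intro sum_sqrt_mult_le) (auto intro: less_imp_le)
  have "harm n \<le> 1 + log 2 (real n)"
    using harm_le_ln[OF \<open>n > 0\<close>] ln_le_log2[of "real n"] \<open>n > 0\<close> by simp
  moreover have "0 \<le> T_QKG D"
    unfolding T using pos by (intro sum_nonneg) (auto intro: less_imp_le)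
  ultimately have "T_QKG D * sqrt (harm n) \<le> T_QKG D * sqrt (1 + log 2 (real n))"
    by (intro mult_left_mono) auto
  moreover have "2 powr (renyi_entropy (2/3) D / 2) \<le> T_QKG D * sqrt (harm n)"
    unfolding T H using pos by (rule sum_sqrt_mult_ge)
  \<comment> \<open>Since \<open>n\<close> is at least 1, the logarithm is nonnegative, so the
    denominator can be cleared.\<close>
  moreover have "0 < sqrt (1 + log 2 (real n))"
    using \<open>n > 0\<close> by (simp add: add_pos_nonneg)
  ultimately show ?thesis
    using upper by (simp add: pos_divide_le_eq flip: n_def)
qed

end
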